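(* Let $\varphi:\mathbb{R}\to(0,\infty)$ be self-neglecting. Let $f:\mathbb{R}\to(0,\infty)$ have the Baire property (respectively, be Lebesgue measurable) and satisfy, for some function $g$, $$\frac{f(x+t\varphi(x))}{f(x)}\to g(t)\quad\text{as }x\to\infty,\qquad\text{for all }t\in\mathbb{R},$$ where $g>0$ on a non-negligible set. Then there is $\rho\in\mathbb{R}$ such that $$g(t)=e^{\rho t}\qquad\text{for all }t\in\mathbb{R}.$$
   Context: A function $\varphi:\mathbb{R}\to(0,\infty)$ is self-neglecting, written $\varphi\in SN$, if $\varphi(x+t\varphi(x))/\varphi(x)\to 1$ as $x\to\infty$, locally uniformly in $t\in\mathbb{R}$ (no measurability or Baire property is included in this definition). "Negligible" means meagre when $f$ has the Baire property, and Lebesgue null when $f$ is measurable. The number $\rho$ is called the index of $\varphi$-regular variation of $f$. *)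

theory Defs
  imports "HOL-Analysis.Analysis"
begin

definition nowhere_dense :: "'a::topological_space set \<Rightarrow> bool" where
  "nowhere_dense S \<longleftrightarrow> interior (closure S) = {}"

definition meagre :: "'a::topological_space set \<Rightarrow> bool" where
  "meagre S \<longleftrightarrow> (\<exists>N :: nat \<Rightarrow> 'a set. (\<forall>n. nowhere_dense (N n)) \<and> S = (\<Union>n. N n))"

definition has_Baire_property :: "'a::topological_space set \<Rightarrow> bool" where
  "has_Baire_property S \<longleftrightarrow> (\<exists>U. open U \<and> meagre ((S - U) \<union> (U - S)))"

definition Baire_function :: "('a::topological_space \<Rightarrow> 'b::topological_space) \<Rightarrow> bool" where
  "Baire_function f \<longleftrightarrow> (\<forall>V. open V \<longrightarrow> has_Baire_property (f -` V))"

definition locally_uniform_limit ::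
  "('t::topological_space \<Rightarrow> 'b::metric_space) \<Rightarrow> ('a \<Rightarrow> 't \<Rightarrow> 'b) \<Rightarrow> 'a filter \<Rightarrow> bool" where
  "locally_uniform_limit l h F \<longleftrightarrow> (\<forall>t. \<exists>U. open U \<and> t \<in> U \<and> uniform_limit U h l F)"

(* The range (0,\<infinity>) is encoded by positivity of a real-valued function;
   no measurability or Baire property of \<phi> is required. *)
definition self_neglecting :: "(real \<Rightarrow> real) \<Rightarrow> bool" where
  "self_neglecting \<phi> \<longleftrightarrow>
     (\<forall>x. \<phi> x > 0) \<and>
     locally_uniform_limit (\<lambda>t. 1) (\<lambda>x t. \<phi> (x + t * \<phi> x) / \<phi> x) at_top"

lemma locally_uniform_limit_iff_compact:
  fixes l :: "'t::heine_borel \<Rightarrow> 'b::metric_space"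
  shows "locally_uniform_limit l h F \<longleftrightarrow> (\<forall>K. compact K \<longrightarrow> uniform_limit K h l F)"
proof (intro iffI allI impI)
  fix K :: "'t set"
  assume "locally_uniform_limit l h F" and K: "compact K"
  then obtain U where U: "\<And>t. open (U t)" "\<And>t. t \<in> U t" "\<And>t. uniform_limit (U t) h l F"
    unfolding locally_uniform_limit_def by metis
  have "K \<subseteq> (\<Union>t\<in>K. U t)"
    using U(2) by auto
  then obtain D where D: "finite D" "K \<subseteq> (\<Union>t\<in>D. U t)"
    using compactE_image[OF K, of K U] U(1) by metis
  have "uniform_limit (\<Union>t\<in>D. U t) h l F"
    using D(1) U(3) by (intro uniform_limit_on_UNION) auto
  then show "uniform_limit K h l F"
    using D(2) by (rule uniform_limit_on_subset)
next
  assume *: "\<forall>K. compact K \<longrightarrow> uniform_limit K h l F"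
  show "locally_uniform_limit l h F"
    unfolding locally_uniform_limit_def
  proof
    fix t
    have "uniform_limit (ball t 1) h l F"
      using *[rule_format, of "cball t 1"] ball_subset_cball
      by (rule uniform_limit_on_subset) simp
    then show "\<exists>U. open U \<and> t \<in> U \<and> uniform_limit U h l F"
      by (intro exI[of _ "ball t 1"]) auto
  qed
qed

end

theory Submission
  imports Defs
begin

text \<open>
  Everything rests on one uniformity statement: \<open>f (x\<^sub>n + u\<^sub>n \<phi>(x\<^sub>n)) / f (x\<^sub>n) \<longlonglongrightarrow> 1\<close> whenever
  \<open>x\<^sub>n \<longlonglongrightarrow> \<infinity>\<close> and \<open>u\<^sub>n \<longlonglongrightarrow> 0\<close>. Put \<open>y\<^sub>n = x\<^sub>n + u\<^sub>n \<phi>(x\<^sub>n)\<close> and \<open>\<gamma>\<^sub>n = \<phi>(y\<^sub>n) / \<phi>(x\<^sub>n) \<longlonglongrightarrow> 1\<close>.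
  The set where \<open>g > 0\<close> is a countable union of sets on which \<open>ln g\<close> oscillates by less than
  \<open>\<delta>\<close> and the convergence along both \<open>x\<^sub>n\<close> and \<open>y\<^sub>n\<close> is \<open>\<delta>\<close>-close from some index on; one of
  them, \<open>A\<close>, is not negligible, so by a Steinhaus argument there are \<open>v, w \<in> A\<close> with
  \<open>w = u\<^sub>n + \<gamma>\<^sub>n v\<close>. Then \<open>x\<^sub>n + w \<phi>(x\<^sub>n) = y\<^sub>n + v \<phi>(y\<^sub>n)\<close>, and comparing the two quotients
  bounds \<open>ln f (y\<^sub>n) - ln f (x\<^sub>n)\<close> by \<open>3\<delta>\<close>. Along a sequence the values \<open>\<phi>(x\<^sub>n)\<close> are mere constants,
  which is why no regularity of \<open>\<phi>\<close> is needed. The uniformity gives both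
  \<open>g (s + t) = g s g t\<close> and the boundedness of \<open>g\<close> near \<open>0\<close>, hence \<open>g\<close> is exponential.
\<close>

section \<open>Meagre sets and sets with the Baire property\<close>

lemma nowhere_dense_mono: "nowhere_dense T \<Longrightarrow> S \<subseteq> T \<Longrightarrow> nowhere_dense S"
  unfolding nowhere_dense_def using interior_mono[OF closure_mono[of S T]] by simp

lemma meagre_mono:
  assumes "meagre T" "S \<subseteq> T"
  shows "meagre S"
proof -
  obtain N :: "nat \<Rightarrow> 'a set" where N: "\<And>n. nowhere_dense (N n)" "T = (\<Union>n. N n)"
    using assms(1) unfolding meagre_def by blast
  have "nowhere_dense (N n \<inter> S)" for n
    using N(1) by (rule nowhere_dense_mono) auto
  moreover have "S = (\<Union>n. N n \<inter> S)"
    using N(2) assms(2) by auto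
  ultimately show ?thesis
    unfolding meagre_def by (intro exI[of _ "\<lambda>n. N n \<inter> S"]) auto
qed

lemma meagre_UN:
  fixes A :: "nat \<Rightarrow> 'a::topological_space set"
  assumes "\<And>n. meagre (A n)"
  shows "meagre (\<Union>n. A n)"
proof -
  have "\<forall>n. \<exists>N. (\<forall>m::nat. nowhere_dense (N m)) \<and> A n = (\<Union>m. N m)"
    using assms unfolding meagre_def by simp
  from choice[OF this] obtain N :: "nat \<Rightarrow> nat \<Rightarrow> 'a set" where
    N: "\<And>n m. nowhere_dense (N n m)" "\<And>n. A n = (\<Union>m. N n m)"
    by blast
  have "(\<Union>n. A n) = (\<Union>k. case_prod N (prod_decode k))"
  proof (intro equalityI subsetI)
    fix x assume "x \<in> (\<Union>n. A n)"
    then obtain n m where "x \<in> N n m"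
      using N(2) by auto
    then have "x \<in> case_prod N (prod_decode (prod_encode (n, m)))"
      by simp
    then show "x \<in> (\<Union>k. case_prod N (prod_decode k))"
      by (rule UN_I[OF UNIV_I])
  next
    fix x assume "x \<in> (\<Union>k. case_prod N (prod_decode k))"
    then obtain k where "x \<in> N (fst (prod_decode k)) (snd (prod_decode k))"
      by (auto simp: case_prod_beta)
    then show "x \<in> (\<Union>n. A n)"
      using N(2) by blast
  qed
  moreover have "nowhere_dense (case_prod N (prod_decode k))" for k
    using N(1) by (simp split: prod.splits)
  ultimately show ?thesis
    unfolding meagre_def by (intro exI[of _ "\<lambda>k. case_prod N (prod_decode k)"]) simp
qed

lemma nowhere_dense_imp_meagre: "nowhere_dense S \<Longrightarrow> meagre S"
  unfolding meagre_def by (intro exI[of _ "\<lambda>n. S"]) auto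

lemma meagre_Un:
  assumes "meagre S" "meagre T"
  shows "meagre (S \<union> T)"
proof -
  have "meagre (\<Union>n::nat. if n = 0 then S else T)"
    by (intro meagre_UN) (use assms in auto)
  then show ?thesis
    by (rule meagre_mono) (auto split: if_splits)
qed

text \<open>The Baire category theorem, applied to the closures of the nowhere dense pieces.\<close>

lemma meagre_interior_empty:
  fixes S :: "'a::complete_space set"
  assumes "meagre S"
  shows "interior S = {}"
proof -
  obtain N :: "nat \<Rightarrow> 'a set" where N: "\<And>n. nowhere_dense (N n)" "S = (\<Union>n. N n)"
    using assms unfolding meagre_def by blast
  have "euclidean interior_of \<Union>(range (\<lambda>n. closure (N n))) = {}"
    by (rule Baire_category_alt)
      (use N(1) in \<open>auto simp: nowhere_dense_def completely_metrizable_space_euclidean\<close>)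
  moreover have "S \<subseteq> \<Union>(range (\<lambda>n. closure (N n)))"
    unfolding N(2) by (intro UN_mono closure_subset order_refl)
  ultimately show ?thesis
    using interior_mono[of S "\<Union>(range (\<lambda>n. closure (N n)))"] by simp
qed

lemma nowhere_dense_vimage:
  assumes h: "homeomorphism UNIV UNIV h k" and S: "nowhere_dense S"
  shows "nowhere_dense (h -` S)"
proof -
  have cont: "continuous_on UNIV h" "continuous_on UNIV k" and inv: "\<And>x. k (h x) = x" "\<And>y. h (k y) = y"
    using h unfolding homeomorphism_def by auto
  have "closed (h -` closure S)"
    using cont(1) by (simp add: closed_vimage)
  then have cl: "closure (h -` S) \<subseteq> h -` closure S"
    by (intro closure_minimal vimage_mono closure_subset)
  have "open (k -` interior (closure (h -` S)))"
    using cont(2) by (simp add: open_vimage)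
  moreover have "k -` interior (closure (h -` S)) \<subseteq> closure S"
  proof
    fix y assume "y \<in> k -` interior (closure (h -` S))"
    then have "h (k y) \<in> closure S"
      using cl interior_subset by blast
    then show "y \<in> closure S"
      by (simp add: inv(2))
  qed
  ultimately have "k -` interior (closure (h -` S)) \<subseteq> interior (closure S)"
    by (rule interior_maximal[rotated])
  then show ?thesis
    using S inv(1) unfolding nowhere_dense_def by (metis equals0I subset_empty vimageI empty_iff)
qed

lemma meagre_vimage:
  assumes "homeomorphism UNIV UNIV h k" "meagre S"
  shows "meagre (h -` S)"
proof -
  obtain N where N: "\<And>n::nat. nowhere_dense (N n)" "S = (\<Union>n. N n)"
    using assms(2) unfolding meagre_def by blast
  then show ?thesis
    unfolding meagre_def using nowhere_dense_vimage[OF assms(1)]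
    by (intro exI[of _ "\<lambda>n. h -` N n"]) auto
qed

lemma has_Baire_property_open: "open U \<Longrightarrow> has_Baire_property U"
  unfolding has_Baire_property_def
  by (intro exI[of _ U]) (auto simp: nowhere_dense_def intro: nowhere_dense_imp_meagre)

lemma has_Baire_property_vimage:
  assumes h: "homeomorphism UNIV UNIV h k" and S: "has_Baire_property S"
  shows "has_Baire_property (h -` S)"
proof -
  obtain U where U: "open U" "meagre ((S - U) \<union> (U - S))"
    using S unfolding has_Baire_property_def by blast
  have "open (h -` U)"
    using h U(1) unfolding homeomorphism_def by (simp add: open_vimage)
  moreover have "meagre ((h -` S - h -` U) \<union> (h -` U - h -` S))"
    using meagre_vimage[OF h U(2)] by (simp add: vimage_Un vimage_Diff)
  ultimately show ?thesis
    unfolding has_Baire_property_def by blast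
qed

lemma interior_open_frontier:
  assumes "open U"
  shows "interior (frontier U) = {}"
proof -
  have "interior (frontier U) \<inter> U = {}"
    using interior_subset[of "frontier U"] assms by (auto simp: frontier_def interior_open)
  then have "interior (frontier U) \<inter> closure U = {}"
    by (simp add: open_Int_closure_eq_empty)
  then show ?thesis
    using interior_subset[of "frontier U"] by (auto simp: frontier_def)
qed

text \<open>If \<open>U\<close> approximates \<open>S\<close>, then \<open>interior (- U)\<close>
  approximates \<open>- S\<close>: passing from \<open>- U\<close> to its interior loses only part
  of the frontier, which is nowhere dense.\<close>

lemma has_Baire_property_Compl:
  assumes "has_Baire_property S"
  shows "has_Baire_property (- S)"
proof -
  obtain U where U: "open U" "meagre ((S - U) \<union> (U - S))"
    using assms unfolding has_Baire_property_def by blast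
  let ?W = "interior (- U)" and ?F = "frontier (- U)"
  have "nowhere_dense ?F"
    using U(1) by (simp add: nowhere_dense_def interior_open_frontier)
  then have "meagre (?F \<union> ((S - U) \<union> (U - S)))"
    using U(2) meagre_Un nowhere_dense_imp_meagre by blast
  then have "meagre ((- S - ?W) \<union> (?W - - S))"
    by (rule meagre_mono)
       (use interior_subset[of "- U"] closure_subset[of "- U"] in \<open>auto simp: frontier_def\<close>)
  then show ?thesis
    unfolding has_Baire_property_def by (intro exI[of _ ?W]) simp
qed

lemma has_Baire_property_UN:
  assumes "\<And>n::nat. has_Baire_property (A n)"
  shows "has_Baire_property (\<Union>n. A n)"
proof -
  have "\<forall>n. \<exists>U. open U \<and> meagre ((A n - U) \<union> (U - A n))"
    using assms unfolding has_Baire_property_def by simp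
  from choice[OF this] obtain U where U: "\<And>n. open (U n)" "\<And>n. meagre ((A n - U n) \<union> (U n - A n))"
    by blast
  have "meagre (\<Union>n. (A n - U n) \<union> (U n - A n))"
    using U(2) by (rule meagre_UN)
  then have "meagre (((\<Union>n. A n) - (\<Union>n. U n)) \<union> ((\<Union>n. U n) - (\<Union>n. A n)))"
    by (rule meagre_mono) auto
  then show ?thesis
    unfolding has_Baire_property_def using U(1) by (intro exI[of _ "\<Union>n. U n"]) auto
qed

lemma sigma_algebra_has_Baire_property: "sigma_algebra UNIV (Collect has_Baire_property)"
  unfolding sigma_algebra_iff2
proof (intro conjI ballI allI impI)
  show "UNIV - S \<in> Collect has_Baire_property" if "S \<in> Collect has_Baire_property" for S :: "'a set"
    using that has_Baire_property_Compl[of S] by (simp add: Compl_eq_Diff_UNIV)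
  show "(\<Union>n. A n) \<in> Collect has_Baire_property" if "range A \<subseteq> Collect has_Baire_property"
    for A :: "nat \<Rightarrow> 'a set"
    using that has_Baire_property_UN[of A] by blast
qed (simp_all add: has_Baire_property_open)

text \<open>Packaging the sigma-algebra as a \<open>measure\<close> turns Baire functions into
  measurable ones, so that category and measure share one argument.\<close>

definition Baire_algebra :: "'a::topological_space measure" where
  "Baire_algebra = sigma UNIV (Collect has_Baire_property)"

lemma space_Baire_algebra: "space Baire_algebra = UNIV"
  by (simp add: Baire_algebra_def)

lemma sets_Baire_algebra: "sets Baire_algebra = Collect has_Baire_property"
  unfolding Baire_algebra_def using sigma_algebra.sets_measure_of_eq[OF sigma_algebra_has_Baire_property] .

lemma Baire_function_imp_borel_measurable:
  "Baire_function f \<Longrightarrow> f \<in> borel_measurable Baire_algebra"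
  unfolding Baire_function_def
  by (intro borel_measurableI) (simp add: space_Baire_algebra sets_Baire_algebra)

lemma homeomorphism_affine_real:
  fixes b c :: real
  assumes "c \<noteq> 0"
  shows "homeomorphism UNIV UNIV (\<lambda>x. b + c * x) (\<lambda>y. (y - b) / c)"
    and "homeomorphism UNIV UNIV (\<lambda>y. (y - b) / c) (\<lambda>x. b + c * x)"
  using assms by (auto intro!: homeomorphismI continuous_intros)

section \<open>Overlap of a large set with its near-identity affine images\<close>

text \<open>The common interface of the two cases: \<open>N\<close> holds the negligible sets, and
  \<open>affine_overlap\<close> is a Steinhaus property for affine maps converging to the
  identity.\<close>

locale affine_null_ideal =
  fixes Q :: "real measure" and N :: "real set set"
  assumes space_UNIV: "space Q = UNIV"
    and affine_measurable: "c \<noteq> 0 \<Longrightarrow> (\<lambda>t. b + c * t) \<in> Q \<rightarrow>\<^sub>M Q"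
    and null_UN: "(\<And>n::nat. A n \<in> N) \<Longrightarrow> (\<Union>n. A n) \<in> N"
    and affine_overlap: "V \<in> sets Q \<Longrightarrow> V \<notin> N \<Longrightarrow> u \<longlonglongrightarrow> 0 \<Longrightarrow> \<gamma> \<longlonglongrightarrow> 1 \<Longrightarrow>
          \<forall>\<^sub>F n in sequentially. \<exists>v\<in>V. u n + \<gamma> n * v \<in> V"

text \<open>Modulo a meagre set, \<open>V\<close> is a nonempty open \<open>U\<close>. If
  \<open>V\<close> missed its affine image, the intersection of \<open>U\<close> with its own image
  would be meagre and open, hence empty.\<close>

lemma affine_null_ideal_Baire: "affine_null_ideal Baire_algebra (Collect meagre)"
proof
  fix b c :: real assume "c \<noteq> 0"
  from has_Baire_property_vimage[OF homeomorphism_affine_real(1)[OF this]]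
  show "(\<lambda>t. b + c * t) \<in> Baire_algebra \<rightarrow>\<^sub>M Baire_algebra"
    by (intro measurableI) (auto simp: space_Baire_algebra sets_Baire_algebra)
next
  fix V :: "real set" and u c :: "nat \<Rightarrow> real"
  assume "V \<in> sets Baire_algebra" and V: "V \<notin> Collect meagre" and u: "u \<longlonglongrightarrow> 0" and c: "c \<longlonglongrightarrow> 1"
  then obtain U where U: "open U" "meagre ((V - U) \<union> (U - V))"
    unfolding sets_Baire_algebra has_Baire_property_def by blast
  have "U \<noteq> {}"
    using U(2) V by auto
  then obtain p where p: "p \<in> U"
    by blast
  \<comment> \<open>The affine preimage of \<open>p\<close> tends to \<open>p\<close>, so eventually
    \<open>p\<close> lies in both \<open>U\<close> and its image.\<close>
  have "(\<lambda>n. (p - u n) / c n) \<longlonglongrightarrow> (p - 0) / 1"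
    by (intro tendsto_intros u c) simp
  then have "\<forall>\<^sub>F n in sequentially. (p - u n) / c n \<in> U"
    using U(1) p by (auto dest: topological_tendstoD)
  moreover have "\<forall>\<^sub>F n in sequentially. c n > 0"
    using c by (rule order_tendstoD) simp
  ultimately show "\<forall>\<^sub>F n in sequentially. \<exists>v\<in>V. u n + c n * v \<in> V"
  proof eventually_elim
    case (elim n)
    let ?k = "\<lambda>y. (y - u n) / c n"
    have k: "homeomorphism UNIV UNIV ?k (\<lambda>x. u n + c n * x)"
      using elim by (intro homeomorphism_affine_real) simp
    show ?case
    proof (rule ccontr)
      assume *: "\<not> ?case"
      \<comment> \<open>Otherwise \<open>v = ?k x\<close> would be a witness, since
        \<open>u n + c n * v = x\<close>.\<close>
      have "x \<notin> V \<or> ?k x \<notin> V" for x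
        using * elim by (metis diff_add_cancel add.commute nonzero_mult_div_cancel_left times_divide_eq_right order_less_irrefl)
      then have "U \<inter> ?k -` U \<subseteq> ((V - U) \<union> (U - V)) \<union> ?k -` ((V - U) \<union> (U - V))"
        by auto
      then have "meagre (U \<inter> ?k -` U)"
        using meagre_mono meagre_Un[OF U(2) meagre_vimage[OF k U(2)]] by blast
      moreover have "open (U \<inter> ?k -` U)"
        using U(1) k unfolding homeomorphism_def by (simp add: open_Int open_vimage)
      ultimately have "U \<inter> ?k -` U = {}"
        using meagre_interior_empty interior_open by metis
      then show False
        using p elim by auto
    qed
  qed
qed (auto simp: space_Baire_algebra meagre_UN)

text \<open>Some bounded piece of \<open>V\<close> has positive finite measure; inner regularity
  with an error below that measure leaves a closed set that is not null.\<close>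

lemma compact_subset_of_positive_measure:
  fixes V :: "real set"
  assumes V: "V \<in> sets lebesgue" "V \<notin> null_sets lebesgue"
  obtains K where "compact K" "K \<subseteq> V" "measure lebesgue K > 0"
proof -
  have "\<exists>n::nat. V \<inter> cball 0 (real n) \<notin> null_sets lebesgue"
  proof (rule ccontr)
    assume "\<nexists>n::nat. V \<inter> cball 0 (real n) \<notin> null_sets lebesgue"
    then have "(\<Union>n::nat. V \<inter> cball 0 (real n)) \<in> null_sets lebesgue"
      by (intro null_sets_UN) auto
    moreover have "(\<Union>n::nat. V \<inter> cball 0 (real n)) = V"
      using real_arch_simple by auto
    ultimately show False
      using V(2) by simp
  qed
  then obtain n :: nat where n: "V \<inter> cball 0 (real n) \<notin> null_sets lebesgue"
    by blast
  let ?L = "V \<inter> cball 0 (real n)"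
  have L: "?L \<in> lmeasurable"
    using V(1) by (intro bounded_set_imp_lmeasurable) (auto simp: bounded_Int)
  then have pos: "measure lebesgue ?L > 0"
    using n by (metis completion.complete_measure_axioms emeasure_eq_measure2 ennreal_0 fmeasurableD null_setsI
        zero_less_measure_iff)
  obtain K where K: "closed K" "K \<subseteq> ?L" "?L - K \<in> lmeasurable"
      "emeasure lebesgue (?L - K) < ennreal (measure lebesgue ?L)"
    using sets_lebesgue_inner_closed[OF fmeasurableD[OF L] pos] by metis
  have "compact K"
    using K(1,2) by (meson bounded_cball bounded_subset compact_eq_bounded_closed inf.boundedE)
  moreover have "measure lebesgue K > 0"
  proof -
    have "measure lebesgue (?L - K) < measure lebesgue ?L"
      using K(3,4) by (simp add: emeasure_eq_measure2 ennreal_less_iff)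
    moreover have "measure lebesgue (?L - K) = measure lebesgue ?L - measure lebesgue K"
      using K(2) L \<open>compact K\<close> by (intro measurable_measure_Diff) (auto intro: lmeasurable_compact fmeasurableD)
    ultimately show ?thesis by simp
  qed
  ultimately show thesis
    using K(2) that by blast
qed

text \<open>For compact \<open>K\<close> inside \<open>V\<close>, a near-identity affine image of
  \<open>K\<close> stays in an open \<open>U\<close> around \<open>K\<close> with
  \<open>U - K\<close> of less than half the measure of \<open>K\<close>. The image keeps more than
  half, so it must meet \<open>K\<close>.\<close>

lemma affine_null_ideal_lebesgue: "affine_null_ideal lebesgue (null_sets lebesgue)"
proof
  fix b c :: real assume "c \<noteq> 0"
  then show "(\<lambda>t. b + c * t) \<in> lebesgue \<rightarrow>\<^sub>M lebesgue"
    using lebesgue_affine_measurable[of "\<lambda>_::real. c" b] by (simp add: mult.commute)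
next
  fix V :: "real set" and u c :: "nat \<Rightarrow> real"
  assume "V \<in> sets lebesgue" "V \<notin> null_sets lebesgue" and u: "u \<longlonglongrightarrow> 0" and c: "c \<longlonglongrightarrow> 1"
  then obtain K where K: "compact K" "K \<subseteq> V" "measure lebesgue K > 0"
    using compact_subset_of_positive_measure by metis
  obtain B where B: "\<And>x. x \<in> K \<Longrightarrow> \<bar>x\<bar> \<le> B"
    using compact_imp_bounded[OF K(1)] unfolding bounded_iff by auto
  let ?m = "measure lebesgue K"
  have K_sets: "K \<in> lmeasurable"
    using K(1) by (rule lmeasurable_compact)
  obtain U where U: "open U" "K \<subseteq> U" "emeasure lebesgue (U - K) < ennreal (?m / 2)"
    using sets_lebesgue_outer_open[OF fmeasurableD[OF K_sets] half_gt_zero[OF K(3)]] .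
  obtain e where e: "e > 0" "(\<Union>x\<in>K. ball x e) \<subseteq> U"
    using compact_subset_open_imp_ball_epsilon_subset[OF K(1) U(1,2)] by metis
  \<comment> \<open>This bounds how far the affine map displaces any point of
    \<open>K\<close>.\<close>
  have "(\<lambda>n. \<bar>u n\<bar> + \<bar>c n - 1\<bar> * B) \<longlonglongrightarrow> \<bar>0\<bar> + \<bar>1 - 1\<bar> * B"
    by (intro tendsto_intros u c)
  then have "\<forall>\<^sub>F n in sequentially. \<bar>u n\<bar> + \<bar>c n - 1\<bar> * B < e"
    using e(1) by (intro order_tendstoD(2)) auto
  moreover have "\<forall>\<^sub>F n in sequentially. c n > 1/2"
    using c by (rule order_tendstoD) simp
  ultimately show "\<forall>\<^sub>F n in sequentially. \<exists>v\<in>V. u n + c n * v \<in> V"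
  proof eventually_elim
    case (elim n)
    let ?T = "(\<lambda>x. c n *\<^sub>R x + u n) ` K"
    have "?T \<subseteq> U"
    proof
      fix y assume "y \<in> ?T"
      then obtain x where x: "x \<in> K" "y = c n * x + u n"
        by auto
      have "\<bar>x - y\<bar> = \<bar>u n + (c n - 1) * x\<bar>"
        unfolding x(2) by (simp add: algebra_simps)
      also have "\<dots> \<le> \<bar>u n\<bar> + \<bar>c n - 1\<bar> * \<bar>x\<bar>"
        by (metis abs_mult abs_triangle_ineq)
      also have "\<dots> \<le> \<bar>u n\<bar> + \<bar>c n - 1\<bar> * B"
        using B[OF x(1)] by (intro add_left_mono mult_left_mono) auto
      also have "\<dots> < e"
        using elim by simp
      finally have "y \<in> ball x e"
        by (simp add: dist_real_def)
      then show "y \<in> U"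
        using x(1) e(2) by blast
    qed
    \<comment> \<open>\<open>?T\<close> has measure above \<open>?m / 2\<close>, which does not fit into \<open>U - K\<close>.\<close>
    have "\<not> ?T \<subseteq> U - K"
    proof
      assume "?T \<subseteq> U - K"
      then have "emeasure lebesgue ?T \<le> emeasure lebesgue (U - K)"
        using borel_open[OF U(1)] borel_compact[OF K(1)]
        by (intro emeasure_mono) (auto intro!: sets.Diff)
      also have "\<dots> < ennreal (?m / 2)"
        by (rule U(3))
      finally have "ennreal (c n * ?m) < ennreal (?m / 2)"
        using emeasure_lebesgue_affine[of "c n" "u n" K] elim K_sets
        by (simp add: emeasure_eq_measure2 ennreal_mult)
      then have "c n * ?m < ?m / 2"
        by (meson ennreal_leI not_less)
      moreover have "?m / 2 < c n * ?m"
        using mult_strict_right_mono[of "1/2" "c n" ?m] elim K(3) by simp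
      ultimately show False by simp
    qed
    then show ?case
      using \<open>?T \<subseteq> U\<close> K(2) by (auto simp: add.commute)
  qed
qed auto

section \<open>Self-neglecting functions\<close>

text \<open>With \<open>t\<close> quantified after \<open>x\<close>, the parameter may depend on
  \<open>x\<close>, as it does in the two lemmas below.\<close>

lemma self_neglecting_eventually:
  assumes "self_neglecting \<phi>" "e > 0"
  shows "\<forall>\<^sub>F x in at_top. \<forall>t. \<bar>t\<bar> \<le> T \<longrightarrow> \<bar>\<phi> (x + t * \<phi> x) / \<phi> x - 1\<bar> < e"
proof -
  have "uniform_limit (cball 0 T) (\<lambda>x t. \<phi> (x + t * \<phi> x) / \<phi> x) (\<lambda>t. 1) at_top"
    using assms(1) unfolding self_neglecting_def locally_uniform_limit_iff_compact by simp
  from uniform_limitD[OF this assms(2)] show ?thesis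
    by (simp add: dist_real_def Ball_def)
qed

text \<open>If \<open>y + t \<phi>(y)\<close> fell below \<open>B\<close>, then \<open>B = y + t' \<phi>(y)\<close> with \<open>t'\<close> in the same compact
  interval, so \<open>\<phi>(y) < 2 \<phi>(B)\<close> and \<open>y\<close> would be bounded.\<close>

lemma self_neglecting_filterlim:
  fixes x t :: "'a \<Rightarrow> real"
  assumes sn: "self_neglecting \<phi>" and x: "filterlim x at_top F" and t: "\<forall>\<^sub>F n in F. \<bar>t n\<bar> \<le> T"
  shows "filterlim (\<lambda>n. x n + t n * \<phi> (x n)) at_top F"
  unfolding filterlim_at_top
proof
  fix B :: real
  have pos: "\<phi> y > 0" for y
    using sn unfolding self_neglecting_def by blast
  \<comment> \<open>The tolerance \<open>1/2\<close> yields \<open>\<phi> y < 2 * \<phi> B\<close>;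
    then \<open>t * \<phi> y\<close> takes away at most \<open>2 * \<bar>T\<bar> * \<phi> B\<close>,
    the margin built into the lower bound on \<open>y\<close>.\<close>
  have "\<forall>\<^sub>F y in at_top. \<forall>t. \<bar>t\<bar> \<le> T \<longrightarrow> B \<le> y + t * \<phi> y"
    using self_neglecting_eventually[OF sn, of "1/2" T, OF half_gt_zero[OF zero_less_one]]
      eventually_ge_at_top[of "B + 2 * \<bar>T\<bar> * \<phi> B"]
  proof eventually_elim
    case (elim y)
    have yB: "B \<le> y"
      using elim(2) pos[of B] by (smt (verit) mult_nonneg_nonneg)
    show ?case
    proof (intro allI impI leI notI)
      fix t assume t: "\<bar>t\<bar> \<le> T" and "y + t * \<phi> y < B"
      define t' where "t' = (B - y) / \<phi> y"
      have B: "y + t' * \<phi> y = B"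
        using pos[of y] by (simp add: t'_def)
      have "t < t'"
        using \<open>y + t * \<phi> y < B\<close> pos[of y] by (simp add: t'_def pos_less_divide_eq)
      moreover have "t' \<le> 0"
        using yB pos[of y] by (simp add: t'_def divide_nonpos_pos)
      ultimately have "\<bar>t'\<bar> \<le> T"
        using t by linarith
      then have "\<bar>\<phi> B / \<phi> y - 1\<bar> < 1/2"
        using elim(1) B by metis
      then have "1 / 2 < \<phi> B / \<phi> y"
        by linarith
      then have "\<phi> y < 2 * \<phi> B"
        using pos[of y] by (simp add: field_simps)
      have "- (t * \<phi> y) \<le> \<bar>T\<bar> * \<phi> y"
        using t pos[of y] mult_right_mono[of "- t" "\<bar>T\<bar>" "\<phi> y"] by simp
      also have "\<dots> \<le> \<bar>T\<bar> * (2 * \<phi> B)"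
        using \<open>\<phi> y < 2 * \<phi> B\<close> by (intro mult_left_mono) auto
      finally show False
        using \<open>y + t * \<phi> y < B\<close> elim(2) by simp
    qed
  qed
  then have "\<forall>\<^sub>F n in F. \<forall>t. \<bar>t\<bar> \<le> T \<longrightarrow> B \<le> x n + t * \<phi> (x n)"
    using x unfolding filterlim_iff by blast
  with t show "\<forall>\<^sub>F n in F. B \<le> x n + t n * \<phi> (x n)"
    by eventually_elim blast
qed

lemma self_neglecting_tendsto:
  fixes x t :: "'a \<Rightarrow> real"
  assumes sn: "self_neglecting \<phi>" and x: "filterlim x at_top F" and t: "\<forall>\<^sub>F n in F. \<bar>t n\<bar> \<le> T"
  shows "((\<lambda>n. \<phi> (x n + t n * \<phi> (x n)) / \<phi> (x n)) \<longlongrightarrow> 1) F"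
proof (rule tendstoI)
  fix e :: real assume "e > 0"
  then have "\<forall>\<^sub>F n in F. \<forall>t. \<bar>t\<bar> \<le> T \<longrightarrow> \<bar>\<phi> (x n + t * \<phi> (x n)) / \<phi> (x n) - 1\<bar> < e"
    using self_neglecting_eventually[OF sn] x unfolding filterlim_iff by blast
  with t show "\<forall>\<^sub>F n in F. dist (\<phi> (x n + t n * \<phi> (x n)) / \<phi> (x n)) 1 < e"
    by eventually_elim (simp add: dist_real_def)
qed

section \<open>Uniform convergence at the origin and the Cauchy equation\<close>

context affine_null_ideal
begin

lemma null_UN_countable:
  fixes A :: "'i::countable \<Rightarrow> real set"
  assumes "\<And>i. A i \<in> N"
  shows "(\<Union>i. A i) \<in> N"
proof -
  have "(\<Union>n. A (from_nat n)) \<in> N"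
    using assms by (intro null_UN)
  moreover have "(\<Union>n. A (from_nat n)) = (\<Union>i. A i)"
    by (metis image_image surj_from_nat)
  ultimately show ?thesis by simp
qed

lemma regular_variation_tendsto_1:
  fixes \<phi> f g :: "real \<Rightarrow> real" and x u :: "nat \<Rightarrow> real"
  assumes sn: "self_neglecting \<phi>" and f_pos: "\<And>x. f x > 0" and f: "f \<in> borel_measurable Q"
    and lim: "\<And>t. ((\<lambda>x. f (x + t * \<phi> x) / f x) \<longlongrightarrow> g t) at_top"
    and large: "{t. g t > 0} \<notin> N"
    and x: "filterlim x at_top sequentially" and u: "u \<longlonglongrightarrow> 0"
  shows "(\<lambda>n. f (x n + u n * \<phi> (x n)) / f (x n)) \<longlonglongrightarrow> 1"
proof -
  define y where "y n = x n + u n * \<phi> (x n)" for n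
  define \<gamma> where "\<gamma> n = \<phi> (y n) / \<phi> (x n)" for n
  have pos: "\<phi> y > 0" for y
    using sn unfolding self_neglecting_def by blast
  have u_bounded: "\<forall>\<^sub>F n in sequentially. \<bar>u n\<bar> \<le> 1"
    using tendstoD[OF u, of 1] by (auto simp: dist_real_def elim: eventually_mono)
  have y: "filterlim y at_top sequentially" and \<gamma>: "\<gamma> \<longlonglongrightarrow> 1"
    unfolding y_def \<gamma>_def
    using self_neglecting_filterlim[OF sn x u_bounded] self_neglecting_tendsto[OF sn x u_bounded] by auto
  define F where "F z t = f (z + t * \<phi> z) / f z" for z t
  have F_pos: "F z t > 0" for z t
    using f_pos by (simp add: F_def)
  have F_meas [measurable]: "F z \<in> borel_measurable Q" for z
  proof -
    have "(\<lambda>t. f (z + \<phi> z * t)) \<in> borel_measurable Q"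
      using measurable_compose[OF affine_measurable f, of "\<phi> z" z] pos[of z] by simp
    then show ?thesis
      unfolding F_def by (simp add: mult.commute)
  qed
  have F_lim: "(\<lambda>n. F (z n) t) \<longlonglongrightarrow> g t" if "filterlim z at_top sequentially" for z and t
    unfolding F_def using filterlim_compose[OF lim that] .
  \<comment> \<open>Along a sequence, \<open>g\<close> is a pointwise limit of measurable
    functions.\<close>
  have g_meas [measurable]: "g \<in> borel_measurable Q"
    by (rule borel_measurable_LIMSEQ_real[OF F_lim[OF x]]) simp_all
  have "(\<lambda>n. ln (f (y n)) - ln (f (x n))) \<longlonglongrightarrow> 0"
  proof (rule tendstoI)
    fix \<epsilon> :: real assume "\<epsilon> > 0"
    \<comment> \<open>One third each for the error at \<open>w\<close>, the error at
      \<open>v\<close>, and the oscillation of \<open>ln g\<close> between them.\<close>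
    define \<delta> where "\<delta> = \<epsilon> / 3"
    have \<delta>: "\<delta> > 0"
      using \<open>\<epsilon> > 0\<close> by (simp add: \<delta>_def)
    \<comment> \<open>The index \<open>j\<close> selects the cell of width \<open>\<delta>\<close>
      containing \<open>ln (g t)\<close>, and from index \<open>m\<close> on both sequences are
      \<open>\<delta>\<close>-close.\<close>
    define A where "A = (\<lambda>(j::int, m::nat). {t \<in> space Q. 0 < g t \<and> \<lfloor>ln (g t) / \<delta>\<rfloor> = j \<and>
      (\<forall>n. m \<le> n \<longrightarrow> \<bar>ln (F (x n) t) - ln (g t)\<bar> < \<delta> \<and> \<bar>ln (F (y n) t) - ln (g t)\<bar> < \<delta>)})"
    have A_meas: "A p \<in> sets Q" for p
      unfolding A_def case_prod_beta by measurable
    have "{t. g t > 0} \<subseteq> (\<Union>p. A p)"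
    proof
      fix t assume "t \<in> {t. g t > 0}"
      then have gt: "g t > 0" by simp
      have close: "\<forall>\<^sub>F n in sequentially. \<bar>ln (F (z n) t) - ln (g t)\<bar> < \<delta>"
        if "filterlim z at_top sequentially" for z
      proof -
        have "(\<lambda>n. ln (F (z n) t)) \<longlonglongrightarrow> ln (g t)"
          using F_lim[OF that] gt by (intro tendsto_ln) auto
        from tendstoD[OF this \<delta>] show ?thesis
          by (simp add: dist_real_def)
      qed
      have "\<forall>\<^sub>F n in sequentially. \<bar>ln (F (x n) t) - ln (g t)\<bar> < \<delta> \<and> \<bar>ln (F (y n) t) - ln (g t)\<bar> < \<delta>"
        using close[OF x] close[OF y] by (rule eventually_conj)
      then obtain m where "\<forall>n\<ge>m. \<bar>ln (F (x n) t) - ln (g t)\<bar> < \<delta> \<and> \<bar>ln (F (y n) t) - ln (g t)\<bar> < \<delta>"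
        unfolding eventually_sequentially by blast
      then have "t \<in> A (\<lfloor>ln (g t) / \<delta>\<rfloor>, m)"
        using gt by (simp add: A_def space_UNIV)
      then show "t \<in> (\<Union>p. A p)"
        by blast
    qed
    moreover have "(\<Union>p. A p) \<subseteq> {t. g t > 0}"
      by (auto simp: A_def)
    ultimately have "(\<Union>p. A p) \<notin> N"
      using large by (metis subset_antisym)
    then obtain j m where jm: "A (j, m) \<notin> N"
      using null_UN_countable[of A] by auto
    show "\<forall>\<^sub>F n in sequentially. dist (ln (f (y n)) - ln (f (x n))) 0 < \<epsilon>"
      using affine_overlap[OF A_meas jm u \<gamma>] eventually_ge_at_top[of m]
    proof eventually_elim
      case (elim n)
      then obtain v w where v: "v \<in> A (j, m)" and w: "w \<in> A (j, m)" and w_eq: "w = u n + \<gamma> n * v"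
        by blast
      have "x n + w * \<phi> (x n) = y n + v * \<phi> (y n)"
        using pos[of "x n"] by (simp add: w_eq \<gamma>_def y_def field_simps)
      then have "F (x n) w / F (y n) v = f (y n) / f (x n)"
        using f_pos[of "y n + v * \<phi> (y n)"] by (simp add: F_def)
      then have "ln (F (x n) w / F (y n) v) = ln (f (y n) / f (x n))"
        by simp
      then have "ln (F (x n) w) - ln (F (y n) v) = ln (f (y n)) - ln (f (x n))"
        using F_pos[of "x n" w] F_pos[of "y n" v] f_pos[of "x n"] f_pos[of "y n"] by (simp add: ln_div)
      moreover have "\<bar>ln (F (x n) w) - ln (g w)\<bar> < \<delta>" "\<bar>ln (F (y n) v) - ln (g v)\<bar> < \<delta>"
        using v w elim(2) by (auto simp: A_def)
      moreover have "\<bar>ln (g w) - ln (g v)\<bar> < \<delta>"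
      proof -
        have "\<lfloor>ln (g w) / \<delta>\<rfloor> = \<lfloor>ln (g v) / \<delta>\<rfloor>"
          using v w by (simp add: A_def)
        then have "\<bar>ln (g w) / \<delta> - ln (g v) / \<delta>\<bar> < 1"
          by linarith
        then show ?thesis
          using \<delta> by (simp add: diff_divide_distrib[symmetric] abs_divide)
      qed
      ultimately show ?case
        unfolding dist_real_def \<delta>_def by linarith
    qed
  qed
  then have "(\<lambda>n. exp (ln (f (y n)) - ln (f (x n)))) \<longlonglongrightarrow> exp 0"
    by (rule tendsto_exp)
  then show ?thesis
    using f_pos by (simp add: exp_diff y_def)
qed

text \<open>From \<open>x n\<close>, a step \<open>s\<close> to \<open>y n\<close> followed by a
  step \<open>t\<close> in the scale \<open>\<phi> (y n)\<close> ends near \<open>z n\<close>,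
  reached by the single step \<open>s + t\<close>. Relative to \<open>\<phi> (z n)\<close> the gap
  tends to 0, so \<open>f\<close> has asymptotically equal values at both ends.\<close>

lemma regular_variation_limit_mult:
  fixes \<phi> f g :: "real \<Rightarrow> real"
  assumes sn: "self_neglecting \<phi>" and f_pos: "\<And>x. f x > 0" and f: "f \<in> borel_measurable Q"
    and lim: "\<And>t. ((\<lambda>x. f (x + t * \<phi> x) / f x) \<longlongrightarrow> g t) at_top"
    and large: "{t. g t > 0} \<notin> N"
  shows "g (s + t) = g s * g t"
proof -
  define x where "x n = real n" for n
  define y where "y n = x n + s * \<phi> (x n)" for n
  define z where "z n = x n + (s + t) * \<phi> (x n)" for n
  \<comment> \<open>Chosen so that \<open>z n + u n * \<phi> (z n) = y n + t * \<phi> (y n)\<close>.\<close>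
  define u where "u n = t * (\<phi> (y n) / \<phi> (x n) - 1) / (\<phi> (z n) / \<phi> (x n))" for n
  have pos: "\<phi> y > 0" for y
    using sn unfolding self_neglecting_def by blast
  have x: "filterlim x at_top sequentially"
    unfolding x_def by (rule filterlim_real_sequentially)
  have y: "filterlim y at_top sequentially" "(\<lambda>n. \<phi> (y n) / \<phi> (x n)) \<longlonglongrightarrow> 1"
    unfolding y_def
    using self_neglecting_filterlim[OF sn x, of "\<lambda>_. s" "\<bar>s\<bar>"]
      self_neglecting_tendsto[OF sn x, of "\<lambda>_. s" "\<bar>s\<bar>"] by auto
  have z: "filterlim z at_top sequentially" "(\<lambda>n. \<phi> (z n) / \<phi> (x n)) \<longlonglongrightarrow> 1"
    unfolding z_def
    using self_neglecting_filterlim[OF sn x, of "\<lambda>_. s + t" "\<bar>s + t\<bar>"]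
      self_neglecting_tendsto[OF sn x, of "\<lambda>_. s + t" "\<bar>s + t\<bar>"] by auto
  have "u \<longlonglongrightarrow> t * (1 - 1) / 1"
    unfolding u_def by (intro tendsto_intros y z) simp
  then have u: "u \<longlonglongrightarrow> 0" by simp
  have uz: "z n + u n * \<phi> (z n) = y n + t * \<phi> (y n)" for n
    using pos[of "x n"] pos[of "z n"] by (simp add: u_def y_def z_def field_simps)
  have "(\<lambda>n. f (y n + t * \<phi> (y n)) / f (z n) * (f (z n) / f (x n))) \<longlonglongrightarrow> 1 * g (s + t)"
  proof (rule tendsto_mult)
    show "(\<lambda>n. f (y n + t * \<phi> (y n)) / f (z n)) \<longlonglongrightarrow> 1"
      using regular_variation_tendsto_1[OF sn f_pos f lim large z(1) u] unfolding uz .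
    show "(\<lambda>n. f (z n) / f (x n)) \<longlonglongrightarrow> g (s + t)"
      unfolding z_def by (rule filterlim_compose[OF lim x])
  qed
  moreover have "(\<lambda>n. f (y n) / f (x n) * (f (y n + t * \<phi> (y n)) / f (y n))) \<longlonglongrightarrow> g s * g t"
    using tendsto_mult[OF filterlim_compose[OF lim x, of s] filterlim_compose[OF lim y(1), of t]]
    by (simp add: y_def)
  \<comment> \<open>Both products telescope to
    \<open>f (y n + t * \<phi> (y n)) / f (x n)\<close>.\<close>
  moreover have "f (y n + t * \<phi> (y n)) / f (z n) * (f (z n) / f (x n)) =
      f (y n) / f (x n) * (f (y n + t * \<phi> (y n)) / f (y n))" for n
    using f_pos[of "y n"] f_pos[of "z n"] by (simp add: field_simps)
  ultimately show ?thesis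
    using LIMSEQ_unique by fastforce
qed

text \<open>Otherwise there are \<open>u n\<close> tending to 0 with \<open>g (u n) > 2\<close>;
  picking for each a large \<open>x n\<close> whose quotient already exceeds 2 contradicts the
  uniformity at the origin.\<close>

lemma regular_variation_limit_bounded_near_0:
  fixes \<phi> f g :: "real \<Rightarrow> real"
  assumes sn: "self_neglecting \<phi>" and f_pos: "\<And>x. f x > 0" and f: "f \<in> borel_measurable Q"
    and lim: "\<And>t. ((\<lambda>x. f (x + t * \<phi> x) / f x) \<longlongrightarrow> g t) at_top"
    and large: "{t. g t > 0} \<notin> N"
  shows "\<exists>d>0. \<forall>u. \<bar>u\<bar> < d \<longrightarrow> g u \<le> 2"
proof (rule ccontr)
  assume *: "\<not> ?thesis"
  have "\<exists>u x. \<bar>u\<bar> < 1 / Suc n \<and> x \<ge> real n \<and> f (x + u * \<phi> x) / f x > 2" for n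
  proof -
    obtain u where u: "\<bar>u\<bar> < 1 / Suc n" "g u > 2"
      using * by (metis not_le of_nat_0_less_iff zero_less_Suc zero_less_divide_1_iff)
    have "\<forall>\<^sub>F x in at_top. f (x + u * \<phi> x) / f x > 2"
      using lim u(2) by (rule order_tendstoD)
    then have "\<forall>\<^sub>F x in at_top. f (x + u * \<phi> x) / f x > 2 \<and> x \<ge> real n"
      using eventually_ge_at_top by (rule eventually_conj)
    then show ?thesis
      using u(1) eventually_happens trivial_limit_at_top_linorder by blast
  qed
  then obtain u x where ux: "\<And>n. \<bar>u n\<bar> < 1 / Suc n" "\<And>n. x n \<ge> real n"
      "\<And>n. f (x n + u n * \<phi> (x n)) / f (x n) > 2"
    by metis
  have "u \<longlonglongrightarrow> 0"
    by (rule Lim_null_comparison[OF _ LIMSEQ_inverse_real_of_nat])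
      (use ux(1) in \<open>auto simp: inverse_eq_divide intro!: always_eventually less_imp_le\<close>)
  moreover have "filterlim x at_top sequentially"
    by (rule filterlim_at_top_mono[OF filterlim_real_sequentially]) (use ux(2) in auto)
  ultimately have "(\<lambda>n. f (x n + u n * \<phi> (x n)) / f (x n)) \<longlonglongrightarrow> 1"
    using regular_variation_tendsto_1[OF sn f_pos f lim large] by blast
  then have "\<forall>\<^sub>F n in sequentially. f (x n + u n * \<phi> (x n)) / f (x n) < 2"
    by (rule order_tendstoD) simp
  then obtain n where "f (x n + u n * \<phi> (x n)) / f (x n) < 2"
    using eventually_happens'[OF sequentially_bot] by blast
  then show False
    using ux(3)[of n] by simp
qed

end

text \<open>Subtracting from an additive function the linear function that agrees with it at one point
  leaves a periodic one, so that a bound near the origin is a global bound.\<close>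

lemma additive_bounded_near_0_imp_linear:
  fixes k :: "real \<Rightarrow> real"
  assumes add: "\<And>s t. k (s + t) = k s + k t" and d: "d > 0" and bound: "\<And>u. \<bar>u\<bar> < d \<Longrightarrow> k u \<le> C"
  shows "\<exists>\<rho>. \<forall>t. k t = \<rho> * t"
proof -
  define p where "p = d / 2"
  define \<rho> where "\<rho> = k p / p"
  define e where "e t = k t - \<rho> * t" for t
  have p: "0 < p" "p < d"
    using d by (auto simp: p_def)
  have e_add: "e (s + t) = e s + e t" for s t
    by (simp add: e_def add algebra_simps)
  have e_0: "e 0 = 0"
    using e_add[of 0 0] by simp
  have e_minus: "e (- t) = - e t" for t
    using e_add[of t "- t"] e_0 by simp
  have e_mult: "e (real n * t) = real n * e t" for n t
    by (induction n) (simp_all add: e_0 e_add distrib_right)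
  have e_p: "e p = 0"
    using p by (simp add: e_def \<rho>_def)
  have e_int: "e (of_int i * p) = 0" for i
  proof (cases i)
    case (nonneg n)
    then show ?thesis by (simp add: e_mult e_p)
  next
    case (neg n)
    have "of_int i * p = - (real (Suc n) * p)"
      unfolding neg of_int_minus of_int_of_nat_eq mult_minus_left ..
    then show ?thesis by (simp only: e_minus e_mult e_p mult_zero_right minus_zero)
  qed
  \<comment> \<open>Reduce \<open>t\<close> modulo the period \<open>p\<close> into
    \<open>[0, p)\<close>, where the bound on \<open>k\<close> applies because
    \<open>p < d\<close>.\<close>
  have e_le: "e t \<le> C + \<bar>\<rho>\<bar> * d" for t
  proof -
    let ?r = "t - of_int \<lfloor>t / p\<rfloor> * p"
    have r: "0 \<le> ?r" "?r < p"
      using p(1) floor_divide_lower[of p t] floor_divide_upper[of p t] by (auto simp: algebra_simps)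
    have "e t = e ?r"
      using e_add[of ?r "of_int \<lfloor>t / p\<rfloor> * p"] e_int by simp
    also have "\<dots> \<le> C + \<bar>\<rho>\<bar> * d"
    proof -
      have "- (\<rho> * ?r) \<le> \<bar>\<rho>\<bar> * ?r"
        using r(1) by (metis abs_ge_minus_self mult_minus_left mult_right_mono)
      also have "\<dots> \<le> \<bar>\<rho>\<bar> * d"
        using r p by (intro mult_left_mono) auto
      finally show ?thesis
        using bound[of ?r] r p by (simp add: e_def)
    qed
    finally show ?thesis .
  qed
  \<comment> \<open>A positive value would have unbounded multiples
    \<open>e (n * t) = n * e t\<close>. Oddness then forces \<open>e = 0\<close>.\<close>
  have e_nonpos: "e t \<le> 0" for t
  proof (rule ccontr)
    assume "\<not> e t \<le> 0"
    then obtain n where "C + \<bar>\<rho>\<bar> * d < real n * e t"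
      using reals_Archimedean3[of "e t"] by auto
    then show False
      using e_le[of "real n * t"] by (simp add: e_mult)
  qed
  have "e t = 0" for t
    using e_nonpos[of t] e_nonpos[of "- t"] e_minus[of t] by simp
  then show ?thesis
    by (intro exI[of _ \<rho>]) (simp add: e_def)
qed

theorem theorem3:
  fixes \<phi> f g :: "real \<Rightarrow> real"
  assumes "self_neglecting \<phi>"
    and "\<And>x. f x > 0"
    and "\<And>t. ((\<lambda>x. f (x + t * \<phi> x) / f x) \<longlongrightarrow> g t) at_top"
    and "(Baire_function f \<and> \<not> meagre {t. g t > 0}) \<or>
         (f \<in> borel_measurable lebesgue \<and> {t. g t > 0} \<notin> null_sets lebesgue)"
  shows "\<exists>\<rho>. \<forall>t. g t = exp (\<rho> * t)"
proof -
  have "\<exists>Q N. affine_null_ideal Q N \<and> f \<in> borel_measurable Q \<and> {t. g t > 0} \<notin> N"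
    using assms(4) affine_null_ideal_Baire affine_null_ideal_lebesgue Baire_function_imp_borel_measurable
    by (metis mem_Collect_eq)
  then obtain Q N where QN: "affine_null_ideal Q N" "f \<in> borel_measurable Q" "{t. g t > 0} \<notin> N"
    by blast
  have g_mult: "g (s + t) = g s * g t" for s t
    using affine_null_ideal.regular_variation_limit_mult[OF QN(1) assms(1,2) QN(2) assms(3) QN(3)] .
  obtain d where d: "d > 0" "\<And>u. \<bar>u\<bar> < d \<Longrightarrow> g u \<le> 2"
    using affine_null_ideal.regular_variation_limit_bounded_near_0[OF QN(1) assms(1,2) QN(2) assms(3) QN(3)]
    by blast
  \<comment> \<open>At \<open>t = 0\<close> the quotient is constantly 1.\<close>
  have "((\<lambda>x. 1) \<longlongrightarrow> g 0) (at_top :: real filter)"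
    using assms(3)[of 0] assms(2) by (simp add: less_imp_neq[symmetric])
  then have g_0: "g 0 = 1"
    by (simp add: tendsto_const_iff)
  \<comment> \<open>Multiplicativity makes \<open>g t\<close> a square, and
    \<open>g t * g (- t) = 1\<close> rules out zero; thus \<open>ln g\<close> is defined and
    additive.\<close>
  have g_pos: "g t > 0" for t
  proof -
    have "g t = g (t / 2) ^ 2"
      using g_mult[of "t / 2" "t / 2"] by (simp add: power2_eq_square)
    moreover have "g t * g (- t) = 1"
      using g_mult[of t "- t"] g_0 by simp
    ultimately show ?thesis
      by (metis mult_zero_left zero_less_power2 zero_neq_one power_zero_numeral)
  qed
  have "\<exists>\<rho>. \<forall>t. ln (g t) = \<rho> * t"
  proof (rule additive_bounded_near_0_imp_linear[OF _ d(1)])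
    show "ln (g (s + t)) = ln (g s) + ln (g t)" for s t
      using g_pos[of s] g_pos[of t] by (simp add: g_mult ln_mult)
    show "ln (g u) \<le> ln 2" if "\<bar>u\<bar> < d" for u
      using d(2)[OF that] g_pos by simp
  qed
  then show ?thesis
    using g_pos by (metis exp_ln)
qed

end
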